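(* Let $G=\langle S\rangle$ be a finitely generated group with finite generating set $S$, and let $X=\Gamma(G,S)$ be its Cayley graph. If there exists a sequence of positive integers $\{r_i\}_{i\geqslant 1}$ such that $\lim_{i\to\infty} r_i=\infty$ and $\lim_{i\to\infty}|S(r_i)|<\infty$, then $G$ is virtually cyclic.
   Context: For a positive integer $r$, $S(r)$ denotes the sphere of radius $r$ centred at the identity element in $\Gamma(G,S)$ with respect to the word metric $d_S$, and $|S(r)|$ denotes the number of vertices (elements of $G$) in that sphere, i.e. the number of $g\in G$ at word distance exactly $r$ from the identity. A group is virtually cyclic if it has a cyclic subgroup of finite index (in particular, finite groups are virtually cyclic). *)

theory Defs
  imports Complex_Main "HOL-Algebra.Elementary_Groups"
begin

text \<open>
  The Cayley graph is undirected, so \<open>S\<close> need not be closed under inverses: \<open>g\<close> and \<open>h\<close> are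
  adjacent iff \<open>h = g s\<close> or \<open>g = h s\<close> for some \<open>s \<in> S\<close>. If \<open>\<one> \<in> S\<close>, this yields loops, which do
  not affect distances. The relation below is the symmetric adjacency relation on the vertex
  set \<open>carrier G\<close>.
\<close>

definition cayley_edges :: "('a, 'b) monoid_scheme \<Rightarrow> 'a set \<Rightarrow> ('a \<times> 'a) set"
  where "cayley_edges G S =
    {(g, h). g \<in> carrier G \<and> h \<in> carrier G \<and>
             (\<exists>s\<in>S. h = g \<otimes>\<^bsub>G\<^esub> s \<or> g = h \<otimes>\<^bsub>G\<^esub> s)}"

text \<open>
  The length of a shortest path in the Cayley graph. The value is meaningful only if such a path
  exists, which \<open>cayley_connected\<close> below ensures when \<open>S\<close> generates \<open>G\<close>.
\<close>

definition word_dist :: "('a, 'b) monoid_scheme \<Rightarrow> 'a set \<Rightarrow> 'a \<Rightarrow> 'a \<Rightarrow> nat"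
  where "word_dist G S g h = (LEAST n. (g, h) \<in> cayley_edges G S ^^ n)"

definition word_sphere :: "('a, 'b) monoid_scheme \<Rightarrow> 'a set \<Rightarrow> nat \<Rightarrow> 'a set"
  where "word_sphere G S r = {g \<in> carrier G. word_dist G S \<one>\<^bsub>G\<^esub> g = r}"

definition virtually_cyclic :: "('a, 'b) monoid_scheme \<Rightarrow> bool"
  where "virtually_cyclic G \<longleftrightarrow>
    (\<exists>H. subgroup H G \<and> cyclic_group (G\<lparr>carrier := H\<rparr>) \<and> finite (rcosets\<^bsub>G\<^esub> H))"

lemma (in group) cayley_connected:
  assumes "S \<subseteq> carrier G" "generate G S = carrier G" "g \<in> carrier G" "h \<in> carrier G"
  shows "\<exists>n. (g, h) \<in> cayley_edges G S ^^ n"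
proof -
  have *: "\<forall>a\<in>carrier G. (a, a \<otimes> x) \<in> (cayley_edges G S)\<^sup>*" if "x \<in> generate G S" for x
    using that
  proof induction
    case one
    then show ?case by simp
  next
    case (incl s)
    then have "(a, a \<otimes> s) \<in> cayley_edges G S" if "a \<in> carrier G" for a
      using that assms(1) by (auto simp: cayley_edges_def)
    then show ?case by blast
  next
    case (inv s)
    then have s: "s \<in> carrier G" using assms(1) by blast
    have "(a, a \<otimes> inv s) \<in> cayley_edges G S" if "a \<in> carrier G" for a
    proof -
      have "a = (a \<otimes> inv s) \<otimes> s" using that s by (simp add: m_assoc)
      then show ?thesis using that s inv by (auto simp: cayley_edges_def)
    qed
    then show ?case by blast
  next
    case (eng x y)
    then have xy: "x \<in> carrier G" "y \<in> carrier G" using assms(2) by auto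
    show ?case
    proof
      fix a assume a: "a \<in> carrier G"
      then have "(a, a \<otimes> x) \<in> (cayley_edges G S)\<^sup>*" using eng by blast
      moreover have "(a \<otimes> x, a \<otimes> x \<otimes> y) \<in> (cayley_edges G S)\<^sup>*" using eng xy a by blast
      ultimately show "(a, a \<otimes> (x \<otimes> y)) \<in> (cayley_edges G S)\<^sup>*"
        using xy a by (simp add: m_assoc)
    qed
  qed
  have "h = g \<otimes> (inv g \<otimes> h)" using assms(3,4) by (simp add: m_assoc[symmetric])
  moreover have "inv g \<otimes> h \<in> generate G S" using assms(2-4) by simp
  ultimately have "(g, h) \<in> (cayley_edges G S)\<^sup>*" using * assms(3) by metis
  then show ?thesis by (simp add: rtrancl_power)
qed

lemma (in group) finite_word_sphere:
  assumes "finite S" "S \<subseteq> carrier G" "generate G S = carrier G"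
  shows "finite (word_sphere G S r)"
proof -
  have ball: "finite {h. (\<one>, h) \<in> cayley_edges G S ^^ n}" for n
  proof (induction n)
    case 0
    then show ?case by simp
  next
    case (Suc n)
    let ?B = "{h. (\<one>, h) \<in> cayley_edges G S ^^ n}"
    have "{h. (\<one>, h) \<in> cayley_edges G S ^^ Suc n}
        \<subseteq> (\<Union>g\<in>?B. \<Union>s\<in>S. {g \<otimes> s, g \<otimes> inv s})"
    proof
      fix h assume "h \<in> {h. (\<one>, h) \<in> cayley_edges G S ^^ Suc n}"
      then obtain g where g: "g \<in> ?B" "(g, h) \<in> cayley_edges G S" by auto
      then obtain s where s: "s \<in> S" "h = g \<otimes> s \<or> g = h \<otimes> s" "h \<in> carrier G"
        by (auto simp: cayley_edges_def)
      have "h = g \<otimes> s \<or> h = g \<otimes> inv s"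
        using s assms(2) by (auto simp: m_assoc)
      then show "h \<in> (\<Union>g\<in>?B. \<Union>s\<in>S. {g \<otimes> s, g \<otimes> inv s})" using g s by blast
    qed
    moreover have "finite (\<Union>g\<in>?B. \<Union>s\<in>S. {g \<otimes> s, g \<otimes> inv s})"
      using Suc assms(1) by blast
    ultimately show ?case by (rule finite_subset)
  qed
  have "word_sphere G S r \<subseteq> {h. (\<one>, h) \<in> cayley_edges G S ^^ r}"
  proof
    fix h assume h: "h \<in> word_sphere G S r"
    then obtain n where "(\<one>, h) \<in> cayley_edges G S ^^ n"
      using cayley_connected[OF assms(2,3)] by (auto simp: word_sphere_def)
    then have "(\<one>, h) \<in> cayley_edges G S ^^ (word_dist G S \<one> h)"
      unfolding word_dist_def by (rule LeastI)
    then show "h \<in> {h. (\<one>, h) \<in> cayley_edges G S ^^ r}"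
      using h by (simp add: word_sphere_def)
  qed
  then show ?thesis using ball finite_subset by blast
qed

end

theory Submission
  imports Defs
begin

text \<open>
  The shortlex-minimal words over \<open>S \<union> S\<inverse>\<close> form a language closed under factors, with exactly one
  word for each group element and \<open>|S(n)|\<close> words of length \<open>n\<close>. The number of words of length \<open>n\<close>
  that extend arbitrarily far on both sides is nondecreasing in \<open>n\<close>; being bounded along a
  subsequence, it is bounded, hence stationary somewhere. So long words are, up to ends of
  bounded length, periodic with bounded period: each has the form \<open>a u\<^sup>k b\<close> with \<open>a\<close>, \<open>u\<close>, \<open>b\<close> from
  a finite set. Since \<open>a u\<^sup>k b = (a u a\<inverse>)\<^sup>k a b\<close>, the group is a finite union of cosets of cyclic
  subgroups, and by B. H. Neumann's lemma one of these has finite index.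
\<close>

section \<open>Factorial languages of bounded complexity\<close>

text \<open>Strip the first block of length \<open>p\<close>: the rest has the same period and, if
  still at least \<open>p\<close> long, begins with the same block.\<close>

lemma periodic_list_decomp:
  assumes "0 < p" and "\<And>t. t + p < length v \<Longrightarrow> v ! t = v ! (t + p)"
  shows "\<exists>k b. v = concat (replicate k (take p v)) @ b \<and> length b < p"
  using assms(2)
proof (induction "length v" arbitrary: v rule: less_induct)
  case less
  show ?case
  proof (cases "length v < p")
    case True
    then have "v = concat (replicate 0 (take p v)) @ v" by simp
    with True show ?thesis by blast
  next
    case False
    let ?d = "drop p v"
    have "?d ! t = ?d ! (t + p)" if "t + p < length ?d" for t
      using that less.prems[of "t + p"] by (simp add: ac_simps)
    moreover have "length ?d < length v" using False assms(1) by simp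
    ultimately obtain k b where kb: "?d = concat (replicate k (take p ?d)) @ b" "length b < p"
      using less.hyps by blast
    show ?thesis
    proof (cases "length ?d < p")
      case True
      have "v = concat (replicate 1 (take p v)) @ ?d" by simp
      with True show ?thesis by blast
    next
      case False
      have "take p ?d = take p v"
        using False less.prems by (intro nth_equalityI) (auto simp: add.commute)
      then have "v = concat (replicate (Suc k) (take p v)) @ b"
        using kb(1) append_take_drop_id[of p v] by (metis append.assoc concat.simps(2) replicate_Suc)
      with kb(2) show ?thesis by blast
    qed
  qed
qed

lemma bounded_nondecreasing_stationary:
  fixes f :: "nat \<Rightarrow> nat"
  assumes "\<And>n. f n \<le> f (Suc n)" and "\<And>n. f n \<le> C"
  shows "\<exists>n. f (Suc n) = f n"
proof (rule ccontr)
  assume "\<not> ?thesis"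
  then have "f n < f (Suc n)" for n using assms(1)[of n] by (metis order_le_imp_less_or_eq)
  then have "n \<le> f n" for n
    by (induction n) (auto intro: le_less_trans simp: Suc_le_eq)
  from this[of "Suc C"] assms(2)[of "Suc C"] show False by simp
qed

definition extendable :: "'c list set \<Rightarrow> nat \<Rightarrow> 'c list \<Rightarrow> bool"
  where "extendable L N y \<longleftrightarrow> (\<exists>x z. N \<le> length x \<and> N \<le> length z \<and> x @ y @ z \<in> L)"

text \<open>For a factorial language over a finite alphabet these are, by compactness, the
  length-\<open>n\<close> factors of bi-infinite words whose finite factors all lie in
  \<open>L\<close>. Quantifying over \<open>N\<close> avoids infinite words.\<close>

definition biextendable :: "'c list set \<Rightarrow> nat \<Rightarrow> 'c list set"
  where "biextendable L n = {y. length y = n \<and> (\<forall>N. extendable L N y)}"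

lemma extendable_antimono: "extendable L N y \<Longrightarrow> M \<le> N \<Longrightarrow> extendable L M y"
  unfolding extendable_def by (meson order_trans)

lemma extendable_butlast:
  assumes "extendable L N (y @ [s])"
  shows "extendable L N y"
proof -
  obtain x z where "N \<le> length x" "N \<le> length z" "x @ (y @ [s]) @ z \<in> L"
    using assms unfolding extendable_def by blast
  then have "N \<le> length x" "N \<le> length (s # z)" "x @ y @ (s # z) \<in> L" by auto
  then show ?thesis unfolding extendable_def by blast
qed

text \<open>Extendability is antitone in \<open>N\<close>, so a word not extendable for every
  \<open>N\<close> fails from some point on; over finitely many words take the largest such
  point.\<close>

lemma finite_uniform_extendable:
  assumes "finite Y"
  shows "\<exists>M. \<forall>y\<in>Y. extendable L M y \<longrightarrow> (\<forall>N. extendable L N y)"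
  using assms
proof induction
  case empty
  then show ?case by simp
next
  case (insert y Y)
  then obtain M where M: "\<forall>y\<in>Y. extendable L M y \<longrightarrow> (\<forall>N. extendable L N y)" by blast
  obtain M' where M': "extendable L M' y \<longrightarrow> (\<forall>N. extendable L N y)" by blast
  have "\<forall>z\<in>insert y Y. extendable L (max M M') z \<longrightarrow> (\<forall>N. extendable L N z)"
    using M M' extendable_antimono[OF _ max.cobounded1] extendable_antimono[OF _ max.cobounded2]
    by (metis insert_iff)
  then show ?case by blast
qed

text \<open>The letter after \<open>y\<close> may vary with the extension chosen; as the alphabet is
  finite, one threshold \<open>M\<close> serves all candidate letters.\<close>

lemma biextendable_right:
  assumes "finite A" "L \<subseteq> lists A" "y \<in> biextendable L n"
  shows "\<exists>s. y @ [s] \<in> biextendable L (Suc n)"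
proof -
  have "finite ((\<lambda>s. y @ [s]) ` A)" using assms(1) by simp
  from finite_uniform_extendable[OF this, of L]
  obtain M where M: "\<And>s N. s \<in> A \<Longrightarrow> extendable L M (y @ [s]) \<Longrightarrow> extendable L N (y @ [s])"
    by blast
  \<comment> \<open>One letter of the right context is used up as \<open>s\<close>, hence
    \<open>Suc M\<close>.\<close>
  have "extendable L (Suc M) y" using assms(3) by (simp add: biextendable_def)
  then obtain x z where xz: "Suc M \<le> length x" "Suc M \<le> length z" "x @ y @ z \<in> L"
    unfolding extendable_def by blast
  then obtain s z' where z: "z = s # z'" by (cases z) auto
  have "s \<in> A" using xz(3) assms(2) z by auto
  moreover have "extendable L M (y @ [s])"
    unfolding extendable_def using xz z by (intro exI[of _ x] exI[of _ z']) auto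
  ultimately have "\<forall>N. extendable L N (y @ [s])" using M by blast
  then show ?thesis using assms(3) by (auto simp: biextendable_def)
qed

text \<open>Surjectivity makes the counts nondecreasing in \<open>n\<close>, and where two
  consecutive counts agree it forces \<open>butlast\<close> to be injective.\<close>

lemma biextendable_butlast:
  assumes "finite A" "L \<subseteq> lists A"
  shows "butlast ` biextendable L (Suc n) = biextendable L n"
proof
  show "butlast ` biextendable L (Suc n) \<subseteq> biextendable L n"
  proof clarify
    fix y assume y: "y \<in> biextendable L (Suc n)"
    then have "y \<noteq> []" by (auto simp: biextendable_def)
    then have "y = butlast y @ [last y]" by simp
    then have "\<forall>N. extendable L N (butlast y)"
      using y extendable_butlast[of L _ "butlast y" "last y"] by (simp add: biextendable_def)
    then show "butlast y \<in> biextendable L n" using y by (simp add: biextendable_def)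
  qed
  show "biextendable L n \<subseteq> butlast ` biextendable L (Suc n)"
    using biextendable_right[OF assms] by (metis butlast_snoc image_eqI subsetI)
qed

text \<open>
  Once the number of biextendable words of length \<open>n\<close> stops growing, each of them has a unique
  continuation, as in the theorem of Morse and Hedlund. The middle part of a word of \<open>L\<close> then runs
  deterministically through finitely many states, hence is eventually periodic.
\<close>

theorem factorial_language_decomp:
  assumes A: "finite A" "L \<subseteq> lists A"
    and fac: "\<And>x y z. x @ y @ z \<in> L \<Longrightarrow> y \<in> L"
    and bd: "\<And>N. \<exists>n\<ge>N. card {w \<in> L. length w = n} \<le> C"
  shows "\<exists>B. \<forall>w\<in>L. \<exists>a u b k. w = a @ concat (replicate k u) @ b \<and>
           length a \<le> B \<and> length u \<le> B \<and> length b \<le> B"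
proof -
  let ?E = "biextendable L"
  have fin: "finite {w \<in> L. length w = n}" for n
    by (rule finite_subset[OF _ finite_lists_length_eq[OF A(1), of n]]) (use A(2) in auto)
  have sub: "?E n \<subseteq> {w \<in> L. length w = n}" for n
    using fac unfolding biextendable_def extendable_def by blast
  have finE: "finite (?E n)" for n using finite_subset[OF sub fin] .
  have mono1: "card (?E n) \<le> card (?E (Suc n))" for n
    using card_image_le[OF finE, of butlast "Suc n"] biextendable_butlast[OF A] by simp
  have "card (?E n) \<le> C" for n
  proof -
    \<comment> \<open>The bound is given only for infinitely many lengths; monotonicity carries it
      down to every length.\<close>
    obtain m where m: "m \<ge> n" "card {w \<in> L. length w = m} \<le> C" using bd by blast
    have "card (?E n) \<le> card (?E m)" using lift_Suc_mono_le[of "\<lambda>n. card (?E n)"] mono1 m(1) by blast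
    also have "\<dots> \<le> C" using card_mono[OF fin sub, of m] m(2) by simp
    finally show ?thesis .
  qed
  then obtain n where n: "card (?E (Suc n)) = card (?E n)"
    using bounded_nondecreasing_stationary[of "\<lambda>n. card (?E n)"] mono1 by blast
  have inj: "inj_on butlast (?E (Suc n))"
    by (intro eq_card_imp_inj_on[OF finE]) (simp add: n biextendable_butlast[OF A])
  \<comment> \<open>A factor of length \<open>Suc n\<close> with at least \<open>M\<close> letters
    on each side is already biextendable.\<close>
  obtain M where M: "\<And>y. y \<in> L \<Longrightarrow> length y = Suc n \<Longrightarrow> extendable L M y \<Longrightarrow> y \<in> ?E (Suc n)"
    using finite_uniform_extendable[OF fin[of "Suc n"], of L] unfolding biextendable_def by blast
  define K where "K = card (?E n)"
  \<comment> \<open>One constant with slack serves twice: a word longer than \<open>B\<close> has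
    room for \<open>K + 1\<close> windows away from both ends, and the pieces \<open>a\<close>,
    \<open>u\<close>, \<open>b\<close> found below stay within \<open>B\<close>.\<close>
  define B where "B = 2 * M + 2 * n + 2 * K + 5"
  have "\<exists>a u b k. w = a @ concat (replicate k u) @ b \<and>
           length a \<le> B \<and> length u \<le> B \<and> length b \<le> B" if w: "w \<in> L" for w
  proof (cases "length w \<le> B")
    case True
    then have "w = w @ concat (replicate 0 []) @ [] \<and> length w \<le> B \<and>
        length ([] :: 'a list) \<le> B \<and> length ([] :: 'a list) \<le> B" by simp
    then show ?thesis by blast
  next
    case False
    \<comment> \<open>\<open>q i\<close> is the state at position \<open>i\<close>; the window
      \<open>y i\<close> adds one letter, and its tail is the next state.\<close>
    define y where "y i = take (Suc n) (drop i w)" for i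
    define q where "q i = take n (drop i w)" for i
    have yE: "y i \<in> ?E (Suc n)" if i: "M \<le> i" "i + Suc n + M \<le> length w" for i
    proof (rule M)
      have eq: "w = take i w @ y i @ drop (Suc n) (drop i w)" by (simp add: y_def del: drop_drop)
      show "y i \<in> L" using fac w eq by metis
      show "length (y i) = Suc n" using i by (simp add: y_def)
      show "extendable L M (y i)" unfolding extendable_def
        by (intro exI[of _ "take i w"] exI[of _ "drop (Suc n) (drop i w)"]) (use i w eq in auto)
    qed
    have yq: "butlast (y i) = q i" if "i + Suc n + M \<le> length w" for i
      using that by (simp add: y_def q_def butlast_take)
    have qE: "q i \<in> ?E n" if "M \<le> i" "i + Suc n + M \<le> length w" for i
      using imageI[OF yE[OF that], of butlast] by (simp only: yq[OF that(2)] biextendable_butlast[OF A])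
    have det: "y i = y j" if "q i = q j" "M \<le> i" "i + Suc n + M \<le> length w"
      "M \<le> j" "j + Suc n + M \<le> length w" for i j
      using inj_onD[OF inj _ yE yE] yq that by metis
    have ql: "q (Suc i) = tl (y i)" for i
      by (simp add: y_def q_def tl_take drop_Suc tl_drop)
    \<comment> \<open>Pigeonhole: \<open>K + 1\<close> positions share at most \<open>K\<close>
      states.\<close>
    have "\<not> inj_on q {M..M+K}"
    proof
      assume "inj_on q {M..M+K}"
      moreover have "q ` {M..M+K} \<subseteq> ?E n" using False by (auto simp: B_def intro!: qE)
      ultimately have "card {M..M+K} \<le> K" unfolding K_def using card_inj_on_le finE by blast
      then show False by simp
    qed
    then obtain i j where ij: "M \<le> i" "i < j" "j \<le> M + K" "q i = q j"
      unfolding inj_on_def by (metis atLeastAtMost_iff linorder_neqE_nat)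
    define p where "p = j - i"
    have per: "q (i + t) = q (i + t + p)" if "i + t + p + n + M \<le> length w" for t
      using that
    proof (induction t)
      case 0
      then show ?case using ij by (simp add: p_def)
    next
      case (Suc t)
      then have "y (i + t) = y (i + t + p)" using ij by (intro det) auto
      then show ?case using ql[of "i + t"] ql[of "i + t + p"] by simp
    qed
    \<comment> \<open>Comparing the last letters of the windows turns the period of the states into
      a period of the letters, from position \<open>i + n\<close> up to the final \<open>M\<close>
      letters.\<close>
    have per': "w ! (i + t + n) = w ! (i + t + p + n)" if "i + t + p + Suc n + M \<le> length w" for t
    proof -
      have "y (i + t) = y (i + t + p)" using ij that per[of t] by (intro det) auto
      then have "y (i + t) ! n = y (i + t + p) ! n" by simp
      then show ?thesis using that by (simp add: y_def)
    qed
    define m where "m = length w - M - (i + n)"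
    define v where "v = take m (drop (i + n) w)"
    have m: "i + n + m + M = length w" using ij False by (simp add: m_def B_def)
    have "v ! t = v ! (t + p)" if "t + p < length v" for t
    proof -
      have "t + p < m" using that by (simp add: v_def)
      then show ?thesis using m per'[of t] by (simp add: v_def ac_simps)
    qed
    moreover have "0 < p" using ij by (simp add: p_def)
    ultimately obtain k b where kb: "v = concat (replicate k (take p v)) @ b" "length b < p"
      using periodic_list_decomp by blast
    have "w = take (i + n) w @ v @ drop m (drop (i + n) w)" by (simp add: v_def del: drop_drop)
    then have "w = take (i + n) w @ concat (replicate k (take p v)) @ (b @ drop m (drop (i + n) w))"
      using kb(1) by (metis append.assoc)
    moreover have "length (take (i + n) w) \<le> B" "length (take p v) \<le> B"
      "length (b @ drop m (drop (i + n) w)) \<le> B"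
      using ij kb(2) m by (auto simp: B_def p_def)
    ultimately show ?thesis by blast
  qed
  then show ?thesis by blast
qed

section \<open>Covering a group by cosets\<close>

text \<open>
  A subgroup \<open>H\<close> can be dropped from the cover unless its own cosets suffice: otherwise some coset
  \<open>H y\<close> is covered by cosets of the other subgroups, and so is every translate of it.
\<close>

lemma (in group) neumann_coset_cover:
  assumes "finite \<H>" and "\<And>H. H \<in> \<H> \<Longrightarrow> subgroup H G"
    and "\<And>H. H \<in> \<H> \<Longrightarrow> finite (F H) \<and> F H \<subseteq> carrier G"
    and "carrier G \<subseteq> (\<Union>H\<in>\<H>. \<Union>x\<in>F H. H #> x)"
  shows "\<exists>H\<in>\<H>. finite (rcosets H)"
  using assms
proof (induction arbitrary: F)
  case empty
  then show ?case by auto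
next
  case (insert H \<H>)
  have H: "subgroup H G" and FH: "finite (F H)" "F H \<subseteq> carrier G" using insert.prems by auto
  show ?case
  proof (cases "carrier G \<subseteq> (\<Union>x\<in>F H. H #> x)")
    case True
    have "rcosets H \<subseteq> (\<lambda>x. H #> x) ` F H"
    proof
      fix X assume "X \<in> rcosets H"
      then obtain g where g: "g \<in> carrier G" "X = H #> g" unfolding RCOSETS_def by blast
      then obtain x where "x \<in> F H" "g \<in> H #> x" using True by blast
      then show "X \<in> (\<lambda>x. H #> x) ` F H" using g repr_independence H FH(2) by blast
    qed
    then show ?thesis using FH(1) finite_surj by blast
  next
    case False
    then obtain y where y: "y \<in> carrier G" "y \<notin> (\<Union>x\<in>F H. H #> x)" by blast
    \<comment> \<open>If \<open>H y\<close> is covered by cosets \<open>K z\<close>, then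
      \<open>H x = H y (y^-1 x)\<close> is covered by the cosets \<open>K z y^-1 x\<close>.\<close>
    define F' where "F' K = F K \<union> (\<lambda>(z, x). z \<otimes> inv y \<otimes> x) ` (F K \<times> F H)" for K
    have "\<exists>K\<in>\<H>. finite (rcosets K)"
    proof (rule insert.IH[of F'])
      show "subgroup K G" if "K \<in> \<H>" for K using that insert.prems by blast
      show "finite (F' K) \<and> F' K \<subseteq> carrier G" if "K \<in> \<H>" for K
      proof -
        have K: "finite (F K)" "F K \<subseteq> carrier G" using insert.prems(2)[of K] that by auto
        then show ?thesis unfolding F'_def using FH y(1) by auto
      qed
      show "carrier G \<subseteq> (\<Union>K\<in>\<H>. \<Union>x\<in>F' K. K #> x)"
      proof
        fix g assume g: "g \<in> carrier G"
        then obtain K x where K: "K \<in> insert H \<H>" "x \<in> F K" "g \<in> K #> x"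
          using insert.prems(3) by blast
        show "g \<in> (\<Union>K\<in>\<H>. \<Union>x\<in>F' K. K #> x)"
        proof (cases "K \<in> \<H>")
          case True
          then show ?thesis using K unfolding F'_def by blast
        next
          case False
          with K have x: "x \<in> F H" "g \<in> H #> x" by auto
          then obtain h where h: "h \<in> H" "g = h \<otimes> x" unfolding r_coset_def by blast
          have hc: "h \<in> carrier G" using subgroup.mem_carrier[OF H h(1)] .
          have xc: "x \<in> carrier G" using x(1) FH(2) by blast
          \<comment> \<open>Otherwise \<open>y\<close> itself would lie in \<open>H x'\<close>,
            against its choice; so \<open>h y\<close> must be covered by another subgroup.\<close>
          have "h \<otimes> y \<notin> H #> x'" if "x' \<in> F H" for x'
          proof
            assume "h \<otimes> y \<in> H #> x'"
            then obtain h' where h': "h' \<in> H" "h \<otimes> y = h' \<otimes> x'" unfolding r_coset_def by blast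
            have c: "h' \<in> carrier G" "x' \<in> carrier G"
              using subgroup.mem_carrier[OF H h'(1)] that FH(2) by auto
            have "y = inv h \<otimes> (h' \<otimes> x')" using h'(2)[symmetric] hc y(1) by (simp add: m_assoc[symmetric])
            then have "y = (inv h \<otimes> h') \<otimes> x'" using hc c by (simp add: m_assoc)
            moreover have "inv h \<otimes> h' \<in> H" using H h(1) h'(1) by (simp add: subgroup_def)
            ultimately have "y \<in> H #> x'" unfolding r_coset_def by blast
            with y(2) that show False by blast
          qed
          moreover have "h \<otimes> y \<in> carrier G" using hc y(1) by simp
          ultimately obtain K' z where K': "K' \<in> \<H>" "z \<in> F K'" "h \<otimes> y \<in> K' #> z"
            using insert.prems(3) by blast
          then obtain k where k: "k \<in> K'" "h \<otimes> y = k \<otimes> z" unfolding r_coset_def by blast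
          have c: "k \<in> carrier G" "z \<in> carrier G"
            using subgroup.mem_carrier[OF insert.prems(1) k(1)] insert.prems(2)[of K'] K' by auto
          have "h = k \<otimes> z \<otimes> inv y" using k(2)[symmetric] hc y(1) by (simp add: m_assoc)
          then have "g = k \<otimes> (z \<otimes> inv y \<otimes> x)" using h(2) c y(1) xc by (simp add: m_assoc)
          then have "g \<in> K' #> (z \<otimes> inv y \<otimes> x)" using k(1) unfolding r_coset_def by blast
          moreover have "z \<otimes> inv y \<otimes> x \<in> F' K'" unfolding F'_def using K'(2) x(1) by force
          ultimately show ?thesis using K'(1) by blast
        qed
      qed
    qed
    then show ?thesis by blast
  qed
qed

lemma (in group) conj_nat_pow:
  assumes "a \<in> carrier G" "h \<in> carrier G"
  shows "(a \<otimes> h \<otimes> inv a) [^] (k::nat) = a \<otimes> h [^] k \<otimes> inv a"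
proof (induction k)
  case 0
  then show ?case using assms by simp
next
  case (Suc k)
  have "a \<otimes> h [^] k \<otimes> inv a \<otimes> (a \<otimes> h \<otimes> inv a) = a \<otimes> h [^] k \<otimes> (inv a \<otimes> a) \<otimes> h \<otimes> inv a"
    using assms by (simp only: m_assoc m_closed inv_closed nat_pow_closed)
  then show ?case using assms Suc by (simp add: m_assoc)
qed

text \<open>Writing \<open>a u^k b = (a u a^-1)^k (a b)\<close> puts each element in a right coset
  of one of finitely many cyclic subgroups, with a representative from the finite set of products
  \<open>a b\<close>.\<close>

lemma (in group) virtually_cyclic_if_cover:
  assumes W: "finite W" "W \<subseteq> carrier G"
    and cover: "\<And>g. g \<in> carrier G \<Longrightarrow> \<exists>a\<in>W. \<exists>u\<in>W. \<exists>b\<in>W. \<exists>k::nat. g = a \<otimes> u [^] k \<otimes> b"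
  shows "virtually_cyclic G"
proof -
  define \<H> where "\<H> = (\<lambda>(a, u). generate G {a \<otimes> u \<otimes> inv a}) ` (W \<times> W)"
  define F where "F = (\<lambda>(a, b). a \<otimes> b) ` (W \<times> W)"
  have "\<exists>H\<in>\<H>. finite (rcosets H)"
  proof (rule neumann_coset_cover[where F = "\<lambda>_. F"])
    show "finite \<H>" unfolding \<H>_def using W by simp
    show "subgroup H G" if "H \<in> \<H>" for H
      using that W(2) unfolding \<H>_def by (auto intro!: generate_is_subgroup)
    show "finite F \<and> F \<subseteq> carrier G" for H using W unfolding F_def by auto
    show "carrier G \<subseteq> (\<Union>H\<in>\<H>. \<Union>x\<in>F. H #> x)"
    proof
      fix g assume "g \<in> carrier G"
      then obtain a u b and k :: nat
        where *: "a \<in> W" "u \<in> W" "b \<in> W" "g = a \<otimes> u [^] k \<otimes> b" using cover by blast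
      then have c: "a \<in> carrier G" "u \<in> carrier G" "b \<in> carrier G" using W(2) by auto
      let ?H = "generate G {a \<otimes> u \<otimes> inv a}"
      have H: "subgroup ?H G" using c by (intro generate_is_subgroup) auto
      have "(a \<otimes> u \<otimes> inv a) [^] k \<in> ?H"
        using c by (auto simp: generate_pow int_pow_int[symmetric])
      moreover have "g = (a \<otimes> u \<otimes> inv a) [^] k \<otimes> (a \<otimes> b)"
      proof -
        have "(a \<otimes> u \<otimes> inv a) [^] k \<otimes> (a \<otimes> b) = a \<otimes> u [^] k \<otimes> (inv a \<otimes> a) \<otimes> b"
          unfolding conj_nat_pow[OF c(1,2)]
          using c by (simp only: m_assoc m_closed inv_closed nat_pow_closed)
        then show ?thesis using c * by simp
      qed
      ultimately have "g \<in> ?H #> (a \<otimes> b)" unfolding r_coset_def by blast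
      moreover have "?H \<in> \<H>" "a \<otimes> b \<in> F" using * unfolding \<H>_def F_def by auto
      ultimately show "g \<in> (\<Union>H\<in>\<H>. \<Union>x\<in>F. H #> x)" by blast
    qed
  qed
  then obtain a u where au: "a \<in> W" "u \<in> W" "finite (rcosets (generate G {a \<otimes> u \<otimes> inv a}))"
    unfolding \<H>_def by auto
  define x where "x = a \<otimes> u \<otimes> inv a"
  have x: "x \<in> carrier G" using au W(2) unfolding x_def by auto
  have sg: "subgroup (generate G {x}) G" using x by (intro generate_is_subgroup) auto
  \<comment> \<open>\<open>subgroup_generated\<close> intersects its generators with the carrier,
    which changes nothing for \<open>x\<close>.\<close>
  have "subgroup_generated G {x} = G\<lparr>carrier := generate G {x}\<rparr>"
    using x by (simp add: subgroup_generated_def)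
  then have "cyclic_group (G\<lparr>carrier := generate G {x}\<rparr>)"
    using cyclic_group_generated[of x] by simp
  then show ?thesis unfolding virtually_cyclic_def using sg au(3) x_def by blast
qed

section \<open>Shortlex normal forms\<close>

text \<open>Letters are natural numbers, to have a total well-founded order that group elements
  lack; \<open>lenlex less_than\<close> is then shortlex.\<close>

definition shortlex_minimal :: "(nat list \<Rightarrow> 'a) \<Rightarrow> nat set \<Rightarrow> nat list set"
  where "shortlex_minimal f A =
    {w \<in> lists A. \<forall>w'\<in>lists A. f w' = f w \<longrightarrow> (w', w) \<notin> lenlex less_than}"

lemma shortlex_minimal_exists:
  assumes "w \<in> lists A"
  shows "\<exists>w'\<in>shortlex_minimal f A. f w' = f w"
proof -
  have "wf (lenlex less_than)" by (intro wf_lenlex wf_less_than)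
  then obtain w' where "w' \<in> {x \<in> lists A. f x = f w}"
    "\<And>x. (x, w') \<in> lenlex less_than \<Longrightarrow> x \<notin> {x \<in> lists A. f x = f w}"
    using assms wfE_min[of "lenlex less_than" w "{x \<in> lists A. f x = f w}"] by blast
  then show ?thesis unfolding shortlex_minimal_def by (intro bexI[of _ w']) auto
qed

text \<open>Shortlex is total, so of two distinct words with equal value one is smaller and the
  other is not minimal.\<close>

lemma inj_on_shortlex_minimal: "inj_on f (shortlex_minimal f A)"
proof (rule inj_onI)
  fix x y assume *: "x \<in> shortlex_minimal f A" "y \<in> shortlex_minimal f A" "f x = f y"
  have "total (lenlex less_than)" by (intro total_lenlex total_less_than)
  then show "x = y" using * unfolding total_on_def shortlex_minimal_def by fastforce
qed

lemma shortlex_minimal_length_le: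
  assumes "w \<in> shortlex_minimal f A" "w' \<in> lists A" "f w' = f w"
  shows "length w \<le> length w'"
  using assms unfolding shortlex_minimal_def lenlex_conv by force

context group
begin

definition word_val :: "(nat \<Rightarrow> 'a) \<Rightarrow> nat list \<Rightarrow> 'a"
  where "word_val val w = foldr (\<lambda>s g. val s \<otimes> g) w \<one>"

lemma word_val_simps [simp]:
  "word_val val [] = \<one>" "word_val val (s # w) = val s \<otimes> word_val val w"
  by (simp_all add: word_val_def)

context
  fixes val :: "nat \<Rightarrow> 'a" and A :: "nat set"
  assumes val: "val ` A \<subseteq> carrier G"
begin

lemma word_val_closed: "w \<in> lists A \<Longrightarrow> word_val val w \<in> carrier G"
  using val by (induction w) auto

lemma word_val_append:
  "v \<in> lists A \<Longrightarrow> w \<in> lists A \<Longrightarrow> word_val val (v @ w) = word_val val v \<otimes> word_val val w"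
proof (induction v)
  case Nil
  then show ?case using word_val_closed by simp
next
  case (Cons s v)
  then have "val s \<in> carrier G" using val by auto
  then show ?case using Cons word_val_closed by (simp add: m_assoc)
qed

lemma word_val_concat_replicate:
  assumes "u \<in> lists A"
  shows "word_val val (concat (replicate k u)) = word_val val u [^] k"
proof (induction k)
  case 0
  then show ?case by simp
next
  case (Suc k)
  have "concat (replicate k u) \<in> lists A" using assms by (induction k) auto
  then have "word_val val (concat (replicate (Suc k) u)) = word_val val u \<otimes> word_val val u [^] k"
    using Suc assms by (simp add: word_val_append)
  then show ?case using nat_pow_Suc2[OF word_val_closed[OF assms]] by simp
qed

text \<open>Replacing \<open>y\<close> by a smaller word of the same value would make the whole word
  smaller without changing its value, since shortlex is compatible with concatenation on both
  sides.\<close>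

lemma shortlex_minimal_factor:
  assumes "x @ y @ z \<in> shortlex_minimal (word_val val) A"
  shows "y \<in> shortlex_minimal (word_val val) A"
proof -
  have l: "x \<in> lists A" "y \<in> lists A" "z \<in> lists A"
    using assms by (auto simp: shortlex_minimal_def)
  have "(y', y) \<notin> lenlex less_than" if y': "y' \<in> lists A" "word_val val y' = word_val val y" for y'
  proof
    assume "(y', y) \<in> lenlex less_than"
    then have "(x @ y' @ z, x @ y @ z) \<in> lenlex less_than"
      using lenlex_append1[of y' y less_than z z] lenlex_append2[of less_than x]
      by (simp add: irrefl_def)
    moreover have "word_val val (x @ y' @ z) = word_val val (x @ y @ z)"
      using l y' by (simp add: word_val_append)
    moreover have "x @ y' @ z \<in> lists A" using l y' by simp
    ultimately show False using assms unfolding shortlex_minimal_def by blast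
  qed
  then show ?thesis using l unfolding shortlex_minimal_def by blast
qed

text \<open>An undirected edge is right multiplication by a generator or its inverse, so paths from
  the identity spell words over the symmetrized alphabet.\<close>

lemma relpow_cayley_edges_iff:
  assumes "S \<subseteq> carrier G" "val ` A = S \<union> m_inv G ` S"
  shows "(\<one>, g) \<in> cayley_edges G S ^^ n \<longleftrightarrow> (\<exists>w\<in>lists A. length w = n \<and> word_val val w = g)"
proof (induction n arbitrary: g)
  case 0
  show ?case by force
next
  case (Suc n)
  have edge: "(g, h) \<in> cayley_edges G S \<longleftrightarrow> (\<exists>s\<in>A. h = g \<otimes> val s)" if "g \<in> carrier G" for g h
  proof -
    have "g = h \<otimes> s \<longleftrightarrow> h = g \<otimes> inv s" if "s \<in> S" "h \<in> carrier G" for s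
      using that assms(1) \<open>g \<in> carrier G\<close> by (auto simp: m_assoc subset_iff)
    then have "(g, h) \<in> cayley_edges G S \<longleftrightarrow> (\<exists>t\<in>S \<union> m_inv G ` S. h = g \<otimes> t)"
      using assms(1) that unfolding cayley_edges_def by (auto simp: subset_iff)
    then show ?thesis unfolding assms(2)[symmetric] by simp
  qed
  show ?case
  proof
    assume "(\<one>, g) \<in> cayley_edges G S ^^ Suc n"
    then obtain h where h: "(\<one>, h) \<in> cayley_edges G S ^^ n" "(h, g) \<in> cayley_edges G S" by auto
    then obtain w where w: "w \<in> lists A" "length w = n" "word_val val w = h" using Suc by blast
    then obtain s where s: "s \<in> A" "g = h \<otimes> val s" using edge h(2) word_val_closed by blast
    have "val s \<in> carrier G" using val s(1) by blast
    then have "w @ [s] \<in> lists A" "length (w @ [s]) = Suc n" "word_val val (w @ [s]) = g"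
      using w s by (auto simp: word_val_append)
    then show "\<exists>w\<in>lists A. length w = Suc n \<and> word_val val w = g" by blast
  next
    assume "\<exists>w\<in>lists A. length w = Suc n \<and> word_val val w = g"
    then obtain w where w: "w \<in> lists A" "length w = Suc n" "word_val val w = g" by blast
    then obtain v s where v: "w = v @ [s]" by (metis length_0_conv nat.distinct(1) rev_exhaust)
    then have s: "v \<in> lists A" "s \<in> A" "val s \<in> carrier G" using w(1) val by auto
    then have "g = word_val val v \<otimes> val s" using w(3) v by (auto simp: word_val_append)
    then have "(word_val val v, g) \<in> cayley_edges G S" using edge word_val_closed s by blast
    moreover have "(\<one>, word_val val v) \<in> cayley_edges G S ^^ n" using Suc s(1) w(2) v by auto
    ultimately show "(\<one>, g) \<in> cayley_edges G S ^^ Suc n" by auto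
  qed
qed

text \<open>Minimal words are geodesic, so those of length \<open>n\<close> map injectively into the
  sphere of radius \<open>n\<close>.\<close>

lemma card_shortlex_minimal_le_word_sphere:
  assumes "finite S" "S \<subseteq> carrier G" "generate G S = carrier G" "val ` A = S \<union> m_inv G ` S"
  shows "card {w \<in> shortlex_minimal (word_val val) A. length w = n} \<le> card (word_sphere G S n)"
proof (rule card_inj_on_le[where f = "word_val val"])
  show "inj_on (word_val val) {w \<in> shortlex_minimal (word_val val) A. length w = n}"
    by (rule inj_on_subset[OF inj_on_shortlex_minimal]) auto
  show "finite (word_sphere G S n)" using finite_word_sphere assms by blast
  show "word_val val ` {w \<in> shortlex_minimal (word_val val) A. length w = n} \<subseteq> word_sphere G S n"
  proof clarify
    fix w assume w: "w \<in> shortlex_minimal (word_val val) A" "n = length w"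
    then have wA: "w \<in> lists A" unfolding shortlex_minimal_def by blast
    have "word_dist G S \<one> (word_val val w) = length w"
      unfolding word_dist_def relpow_cayley_edges_iff[OF assms(2,4)]
      by (rule Least_equality) (use wA shortlex_minimal_length_le[OF w(1)] in auto)
    then show "word_val val w \<in> word_sphere G S (length w)"
      using wA word_val_closed by (simp add: word_sphere_def)
  qed
qed

end

end

theorem theorem3:
  fixes G :: "('a, 'b) monoid_scheme" and S :: "'a set" and r :: "nat \<Rightarrow> nat"
  assumes "group G"
    and "finite S" and "S \<subseteq> carrier G" and "generate G S = carrier G"
    and "\<And>i. i \<ge> 1 \<Longrightarrow> r i > 0"
    and "filterlim r at_top sequentially"
    and "convergent (\<lambda>i. real (card (word_sphere G S (r i))))"
  shows "virtually_cyclic G"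
proof -
  interpret group G by fact
  let ?T = "S \<union> m_inv G ` S"
  have "finite ?T" using assms(2) by simp
  \<comment> \<open>Numbering the symmetrized generators provides the ordered alphabet.\<close>
  then obtain val :: "nat \<Rightarrow> 'a" and m where "?T = val ` {i. i < (m::nat)}"
    using finite_imp_nat_seg_image_inj_on[of ?T] by metis
  then obtain A :: "nat set" where A: "finite A" "val ` A = ?T" by auto
  have valc: "val ` A \<subseteq> carrier G" using A(2) assms(3) by auto
  let ?f = "word_val val"
  let ?L = "shortlex_minimal ?f A"
  obtain c where c: "\<And>i. norm (real (card (word_sphere G S (r i)))) \<le> c"
    using convergent_imp_Bseq[OF assms(7)] unfolding Bseq_def by blast
  \<comment> \<open>A convergent sequence of sphere sizes is bounded, and \<open>r\<close> takes
    arbitrarily large values.\<close>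
  have bd: "\<exists>n\<ge>N. card {w \<in> ?L. length w = n} \<le> nat \<lceil>c\<rceil>" for N
  proof -
    obtain i where i: "N \<le> r i"
      using assms(6) unfolding filterlim_at_top eventually_sequentially by blast
    have "card {w \<in> ?L. length w = r i} \<le> card (word_sphere G S (r i))"
      using card_shortlex_minimal_le_word_sphere[OF valc assms(2-4) A(2)] .
    also have "\<dots> \<le> nat \<lceil>c\<rceil>" using c[of i] by simp linarith
    finally show ?thesis using i by blast
  qed
  have L: "?L \<subseteq> lists A" by (auto simp: shortlex_minimal_def)
  obtain B where B: "\<forall>w\<in>?L. \<exists>a u b k. w = a @ concat (replicate k u) @ b \<and>
           length a \<le> B \<and> length u \<le> B \<and> length b \<le> B"
    using factorial_language_decomp[OF A(1) L _ bd] shortlex_minimal_factor[OF valc] by blast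
  define W where "W = ?f ` {w. set w \<subseteq> A \<and> length w \<le> B}"
  show ?thesis
  proof (rule virtually_cyclic_if_cover)
    show "finite W" unfolding W_def using finite_lists_length_le[OF A(1)] by simp
    show "W \<subseteq> carrier G" unfolding W_def using word_val_closed[OF valc] by auto
    fix g assume g: "g \<in> carrier G"
    obtain n where "(\<one>\<^bsub>G\<^esub>, g) \<in> cayley_edges G S ^^ n"
      using cayley_connected[OF assms(3,4) one_closed g] by blast
    then obtain w where "w \<in> lists A" "?f w = g"
      using relpow_cayley_edges_iff[OF valc assms(3) A(2)] by blast
    then obtain w where w: "w \<in> ?L" "?f w = g" using shortlex_minimal_exists by metis
    then obtain a u b k where d: "w = a @ concat (replicate k u) @ b"
      "length a \<le> B" "length u \<le> B" "length b \<le> B" using B by blast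
    have l: "a \<in> lists A" "b \<in> lists A" "concat (replicate k u) \<in> lists A"
      using w(1) d(1) by (auto simp: shortlex_minimal_def)
    show "\<exists>a\<in>W. \<exists>u\<in>W. \<exists>b\<in>W. \<exists>k::nat. g = a \<otimes>\<^bsub>G\<^esub> u [^]\<^bsub>G\<^esub> k \<otimes>\<^bsub>G\<^esub> b"
    \<comment> \<open>For \<open>k = 0\<close> the decomposition says nothing about the letters of
      \<open>u\<close>, so its value may lie outside \<open>W\<close>; the value of \<open>a\<close>
      with exponent 0 takes its place.\<close>
    proof (cases "k = 0")
      case True
      then have "g = ?f a \<otimes>\<^bsub>G\<^esub> ?f a [^]\<^bsub>G\<^esub> (0::nat) \<otimes>\<^bsub>G\<^esub> ?f b"
        using w(2) d(1) l word_val_append[OF valc] word_val_closed[OF valc] by simp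
      moreover have "?f a \<in> W" "?f b \<in> W" using l d unfolding W_def by auto
      ultimately show ?thesis by blast
    next
      case False
      then have u: "u \<in> lists A" using l(3) by auto
      then have "g = ?f a \<otimes>\<^bsub>G\<^esub> ?f u [^]\<^bsub>G\<^esub> k \<otimes>\<^bsub>G\<^esub> ?f b"
        using w(2) d(1) l word_val_append[OF valc] word_val_closed[OF valc]
          word_val_concat_replicate[OF valc u]
        by (simp add: m_assoc del: in_lists_conv_set)
      moreover have "?f a \<in> W" "?f u \<in> W" "?f b \<in> W" using l u d unfolding W_def by auto
      ultimately show ?thesis by blast
    qed
  qed
qed

end
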